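(* For every positive integer $k$, the limit $\lim_{n\to\infty}\frac{\tilde{r}(K_{1,k},P_n)}{n}$ exists (as a finite real number).
   Context: For finite graphs $G$ and $H$, the online Ramsey game is played by Builder and Painter on the infinite complete graph $K_{\mathbb{N}}$ with vertex set $\mathbb{N}$. In each round Builder chooses an edge of $K_{\mathbb{N}}$ and Painter immediately and irrevocably colors it red or blue. (Builder may re-choose an already chosen edge, which keeps its color; this gives Builder no advantage.) The online Ramsey number $\tilde{r}(G,H)$ is the smallest integer $t$ for which Builder has a strategy that guarantees, regardless of Painter's choices, a red copy of $G$ or a blue copy of $H$ (as a not necessarily induced subgraph) within at most $t$ rounds. $P_n$ denotes the path on $n$ vertices and $K_{1,k}$ the star with $k$ edges. *)

theory Defs
  imports Complex_Main "HOL-Library.Ramsey"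
begin

text \<open>A graph is given by its vertex set and its set of edges, each edge being a two-element
  set of vertices. The definitions below are meant for finite graphs.\<close>

type_synonym 'a ugraph = "'a set \<times> 'a set set"

definition path_graph :: "nat \<Rightarrow> nat ugraph" where
  "path_graph n = ({..<n}, {{i, Suc i} | i. Suc i < n})"

definition star_graph :: "nat \<Rightarrow> nat ugraph" where
  "star_graph k = ({..k}, {{0, i} | i. 1 \<le> i \<and> i \<le> k})"

text \<open>The host is an edge set on the vertex set \<open>\<nat>\<close>; the copy need not be induced.\<close>

definition has_copy :: "'a ugraph \<Rightarrow> nat set set \<Rightarrow> bool" where
  "has_copy G F \<longleftrightarrow> (\<exists>f. inj_on f (fst G) \<and> (\<forall>e\<in>snd G. f ` e \<in> F))"

datatype colour = Red | Blue

text \<open>A history lists the rounds played so far, oldest first: Builder's edge and the colour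
  it carries.\<close>

type_synonym history = "(nat set \<times> colour) list"

definition edges_of_colour :: "colour \<Rightarrow> history \<Rightarrow> nat set set" where
  "edges_of_colour c h = {e. (e, c) \<in> set h}"

definition builder_strategy :: "(history \<Rightarrow> nat set) \<Rightarrow> bool" where
  "builder_strategy \<sigma> \<longleftrightarrow> (\<forall>h. \<sigma> h \<in> nsets UNIV 2)"

text \<open>The histories that can arise when Builder follows \<open>\<sigma>\<close>. Painter's colours are arbitrary,
  except that a re-chosen edge keeps its colour, which is what \<^const>\<open>single_valued\<close> says.\<close>

definition play :: "(history \<Rightarrow> nat set) \<Rightarrow> history \<Rightarrow> bool" where
  "play \<sigma> h \<longleftrightarrow> (\<forall>i<length h. fst (h ! i) = \<sigma> (take i h)) \<and> single_valued (set h)"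

definition builder_wins_within :: "'a ugraph \<Rightarrow> 'b ugraph \<Rightarrow> nat \<Rightarrow> bool" where
  "builder_wins_within G H t \<longleftrightarrow>
     (\<exists>\<sigma>. builder_strategy \<sigma> \<and>
       (\<forall>h. play \<sigma> h \<and> length h = t \<longrightarrow>
         (\<exists>s\<le>t. has_copy G (edges_of_colour Red (take s h)) \<or>
                has_copy H (edges_of_colour Blue (take s h)))))"

definition online_ramsey :: "'a ugraph \<Rightarrow> 'b ugraph \<Rightarrow> nat" where
  "online_ramsey G H = (LEAST t. builder_wins_within G H t)"

end

theory Submission imports Defs begin

text \<open>
  Write \<open>r(n)\<close> for the online Ramsey number of the star with \<open>k\<close> edges against the path on
  \<open>n\<close> vertices. The limit exists because \<open>r\<close> is subadditive up to a constant,
  \<open>r(n + m) \<le> r(n) + r(m) + k\<^sup>2\<close> (lemma \<open>star_path_number_add\<close>), so that Fekete's lemma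
  applies to \<open>r(n) + k\<^sup>2\<close>, and the constant disappears after division by \<open>n\<close>.

  The source of the inequality is that Painter cannot refuse to give Builder a blue edge for long:
  if Builder joins one vertex \<open>v\<close> to \<open>k\<close> other vertices, then one of these edges is
  blue, or \<open>v\<close> is the centre of a red star (\<open>forces_probe\<close>). Suppose that Builder has a
  blue path on \<open>n\<close> vertices and, on vertices disjoint from it, a blue path on
  \<open>m + k - 1\<close> vertices. Joining the end of the first to the first \<open>k\<close> vertices of
  the second yields a blue edge that cuts off at most \<open>k - 1\<close> vertices of the second path, so
  a blue path on \<open>n + m\<close> vertices arises (\<open>forces_concat\<close>). The \<open>k - 1\<close> surplus
  vertices are themselves obtained by probing \<open>k\<close> fresh vertices for each of them
  (\<open>forces_extend\<close>), which costs \<open>(k - 1) * k\<close> rounds, and \<open>(k - 1) * k + k = k\<^sup>2\<close>.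
  Extension from a single vertex also shows that Builder wins within a finite number of rounds, so
  that \<open>r(n)\<close> is a genuine minimum.

  Plans such as ``play this strategy, then that one on fresh vertices'' are awkward for
  strategies given as functions of the history. They become short inductions once winning is
  defined by recursion on the number of rounds that remain, with only the sets of red and blue edges
  as the position.
\<close>

section \<open>The game in terms of positions\<close>

text \<open>Builder can guarantee a position satisfying \<open>P\<close> after exactly \<open>t\<close> further rounds, from
  red edges \<open>R\<close> and blue edges \<open>B\<close>. A re-chosen edge leaves Painter one colour only, which
  is why each colour is considered only if the edge does not have the other one.\<close>

primrec forces ::
  "(nat set set \<Rightarrow> nat set set \<Rightarrow> bool) \<Rightarrow> nat \<Rightarrow> nat set set \<Rightarrow> nat set set \<Rightarrow> bool" where
  "forces P 0 R B \<longleftrightarrow> P R B"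
| "forces P (Suc t) R B \<longleftrightarrow>
     (\<exists>e\<in>nsets UNIV 2. (e \<notin> B \<longrightarrow> forces P t (insert e R) B) \<and>
                       (e \<notin> R \<longrightarrow> forces P t R (insert e B)))"

lemma edges_of_colour_snoc:
  "edges_of_colour c (h @ [(e, d)]) =
     (if c = d then insert e (edges_of_colour c h) else edges_of_colour c h)"
  by (auto simp: edges_of_colour_def)

lemma edges_of_colour_take: "edges_of_colour c (take s h) \<subseteq> edges_of_colour c h"
  by (auto simp: edges_of_colour_def dest: in_set_takeD)

lemma has_copy_mono: "has_copy G F \<Longrightarrow> F \<subseteq> F' \<Longrightarrow> has_copy G F'"
  unfolding has_copy_def by blast

lemma play_snoc:
  "play \<sigma> (h @ [(e, c)]) \<longleftrightarrow>
     play \<sigma> h \<and> e = \<sigma> h \<and> (\<forall>d. d \<noteq> c \<longrightarrow> e \<notin> edges_of_colour d h)"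
proof -
  have "single_valued (insert (e, c) (set h)) \<longleftrightarrow>
      single_valued (set h) \<and> (\<forall>d. d \<noteq> c \<longrightarrow> e \<notin> edges_of_colour d h)"
    unfolding single_valued_def edges_of_colour_def by auto
  then show ?thesis
    unfolding play_def by (auto simp: nth_append less_Suc_eq)
qed

text \<open>A winning strategy wins from each position that it can meet, by backward induction from the
  final round: every colour that is legal in the recursive game extends the play.\<close>

lemma forces_if_strategy:
  assumes strat: "builder_strategy \<sigma>"
    and win: "\<And>h. play \<sigma> h \<Longrightarrow> length h = T \<Longrightarrow> P (edges_of_colour Red h) (edges_of_colour Blue h)"
  shows "play \<sigma> h \<Longrightarrow> length h + t = T \<Longrightarrow>
    forces P t (edges_of_colour Red h) (edges_of_colour Blue h)"
proof (induction t arbitrary: h)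
  case 0
  then show ?case using win by simp
next
  case (Suc t)
  have "forces P t (edges_of_colour Red (h @ [(\<sigma> h, c)])) (edges_of_colour Blue (h @ [(\<sigma> h, c)]))"
    if "\<forall>d. d \<noteq> c \<longrightarrow> \<sigma> h \<notin> edges_of_colour d h" for c
    using Suc that by (simp add: play_snoc)
  from this[of Red] this[of Blue] strat show ?case
    unfolding forces.simps builder_strategy_def edges_of_colour_snoc
    by (metis (full_types) colour.exhaust colour.distinct(1))
qed

text \<open>Conversely, Builder chooses at each history some edge that keeps the position winning for
  the number of rounds that remain; this invariant holds along every play.\<close>

lemma strategy_if_forces:
  assumes "forces P T {} {}"
  obtains \<sigma> where "builder_strategy \<sigma>"
    and "\<And>h. play \<sigma> h \<Longrightarrow> length h = T \<Longrightarrow> P (edges_of_colour Red h) (edges_of_colour Blue h)"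
proof -
  define good where "good h e \<longleftrightarrow> e \<in> nsets UNIV 2 \<and>
      (let t = T - Suc (length h); R = edges_of_colour Red h; B = edges_of_colour Blue h
       in (e \<notin> B \<longrightarrow> forces P t (insert e R) B) \<and> (e \<notin> R \<longrightarrow> forces P t R (insert e B)))"
    for h :: history and e :: "nat set"
  \<comment> \<open>The default edge only makes \<open>\<sigma>\<close> a legal strategy at histories that lose the invariant.\<close>
  define \<sigma> where "\<sigma> h = (if \<exists>e. good h e then SOME e. good h e else {0, 1})" for h
  have good: "good h (\<sigma> h)" if "good h e" for h e
    using that unfolding \<sigma>_def by (metis someI)
  have "{0, 1} \<in> nsets (UNIV :: nat set) 2"
    by (simp add: nsets_def)
  then have "\<sigma> h \<in> nsets UNIV 2" for h
    using good unfolding \<sigma>_def by (metis good_def)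
  then have strat: "builder_strategy \<sigma>"
    by (simp add: builder_strategy_def)
  have inv: "forces P (T - length h) (edges_of_colour Red h) (edges_of_colour Blue h)"
    if "play \<sigma> h" "length h \<le> T" for h
    using that
  proof (induction h rule: rev_induct)
    case Nil
    then show ?case using assms by (simp add: edges_of_colour_def)
  next
    case (snoc x h)
    obtain e c where x: "x = (e, c)" by fastforce
    have len: "T - length h = Suc (T - Suc (length h))" "T - length (h @ [x]) = T - Suc (length h)"
      using snoc.prems by auto
    have play: "play \<sigma> h" "e = \<sigma> h" "\<forall>d. d \<noteq> c \<longrightarrow> e \<notin> edges_of_colour d h"
      using snoc.prems(1) unfolding x play_snoc by auto
    have "forces P (T - length h) (edges_of_colour Red h) (edges_of_colour Blue h)"
      using snoc play by simp
    then have "\<exists>e. good h e"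
      unfolding len forces.simps good_def Let_def by blast
    then have "good h e"
      using good play(2) by blast
    with play(3) show ?case
      unfolding len x edges_of_colour_snoc good_def Let_def by (cases c) auto
  qed
  show ?thesis
    by (rule that[OF strat]) (use inv in fastforce)
qed

lemma builder_wins_within_iff_forces:
  "builder_wins_within G H t \<longleftrightarrow> forces (\<lambda>R B. has_copy G R \<or> has_copy H B) t {} {}"
    (is "_ \<longleftrightarrow> forces ?P t {} {}")
proof
  assume "builder_wins_within G H t"
  then obtain \<sigma> where strat: "builder_strategy \<sigma>"
    and win: "\<And>h. play \<sigma> h \<Longrightarrow> length h = t \<Longrightarrow>
      \<exists>s\<le>t. has_copy G (edges_of_colour Red (take s h)) \<or> has_copy H (edges_of_colour Blue (take s h))"
    unfolding builder_wins_within_def by blast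
  have "?P (edges_of_colour Red h) (edges_of_colour Blue h)" if "play \<sigma> h" "length h = t" for h
    using win[OF that] has_copy_mono edges_of_colour_take by metis
  from forces_if_strategy[of \<sigma> t ?P "[]" t, OF strat this] show "forces ?P t {} {}"
    by (simp add: play_def edges_of_colour_def)
next
  assume "forces ?P t {} {}"
  then obtain \<sigma> where "builder_strategy \<sigma>"
    and "\<And>h. play \<sigma> h \<Longrightarrow> length h = t \<Longrightarrow> ?P (edges_of_colour Red h) (edges_of_colour Blue h)"
    using strategy_if_forces by blast
  then show "builder_wins_within G H t"
    unfolding builder_wins_within_def by (metis order_refl take_all)
qed

section \<open>Combining strategies\<close>

text \<open>The second plan may depend on the position in which the first one ends, so vertices can be
  chosen relative to a path that the first plan has produced.\<close>

lemma forces_trans: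
  "forces P s R B \<Longrightarrow> (\<And>R B. P R B \<Longrightarrow> forces Q t R B) \<Longrightarrow> forces Q (s + t) R B"
proof (induction s arbitrary: R B)
  case (Suc s)
  then show ?case unfolding forces.simps add_Suc by blast
qed simp

lemma forces_weaken:
  "forces P t R B \<Longrightarrow> (\<And>R B. P R B \<Longrightarrow> Q R B) \<Longrightarrow> forces Q t R B"
  using forces_trans[of P t R B Q 0] by simp

lemma forces_stable:
  assumes "\<And>e R B. P R B \<Longrightarrow> P (insert e R) B" "\<And>e R B. P R B \<Longrightarrow> P R (insert e B)"
  shows "P R B \<Longrightarrow> forces P t R B"
proof (induction t arbitrary: R B)
  case (Suc t)
  moreover have "{0, 1} \<in> nsets (UNIV :: nat set) 2"
    by (simp add: nsets_def)
  ultimately show ?case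
    unfolding forces.simps using assms by blast
qed simp

text \<open>A plan can be carried out on renamed vertices and with other edges on the board: edges
  that are already there only restrict Painter, because a move whose colour is determined by
  \<open>R\<^sub>0\<close> or \<open>B\<^sub>0\<close> is answered as some free move could have been answered. Hence
  \<open>\<phi>\<close> need not avoid the old edges.\<close>

lemma forces_relabel:
  assumes "inj \<phi>"
  shows "forces P t R B \<Longrightarrow>
    forces (\<lambda>R' B'. \<exists>R B. P R B \<and> R' = R\<^sub>0 \<union> image \<phi> ` R \<and> B' = B\<^sub>0 \<union> image \<phi> ` B) t
      (R\<^sub>0 \<union> image \<phi> ` R) (B\<^sub>0 \<union> image \<phi> ` B)"
proof (induction t arbitrary: R B)
  case (Suc t)
  then obtain e where e: "e \<in> nsets UNIV 2"
    and "e \<notin> B \<longrightarrow> forces P t (insert e R) B" "e \<notin> R \<longrightarrow> forces P t R (insert e B)"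
    by auto
  moreover have "\<phi> ` e \<in> nsets UNIV 2"
    using e assms by (auto simp: nsets_def card_image inj_on_subset)
  ultimately show ?case
    unfolding forces.simps
    using Suc.IH[of "insert e R" B] Suc.IH[of R "insert e B"]
    by (intro bexI[of _ "\<phi> ` e"]) auto
qed auto

section \<open>Red stars and blue paths\<close>

definition path_in :: "nat set set \<Rightarrow> nat \<Rightarrow> (nat \<Rightarrow> nat) \<Rightarrow> bool" where
  "path_in F n f \<longleftrightarrow> inj_on f {..<n} \<and> (\<forall>i. Suc i < n \<longrightarrow> {f i, f (Suc i)} \<in> F)"

lemma has_copy_path_graph_iff: "has_copy (path_graph n) F \<longleftrightarrow> (\<exists>f. path_in F n f)"
proof -
  have "(\<forall>e\<in>snd (path_graph n). f ` e \<in> F) \<longleftrightarrow> (\<forall>i. Suc i < n \<longrightarrow> {f i, f (Suc i)} \<in> F)" for f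
  proof -
    have "snd (path_graph n) = (\<lambda>i. {i, Suc i}) ` {i. Suc i < n}"
      unfolding path_graph_def by auto
    then show ?thesis by simp
  qed
  then show ?thesis
    unfolding has_copy_def path_in_def by (simp add: path_graph_def)
qed

lemma path_in_mono: "path_in F n f \<Longrightarrow> F \<subseteq> F' \<Longrightarrow> path_in F' n f"
  unfolding path_in_def by blast

lemma path_in_relabel:
  assumes "inj \<phi>" "path_in F n f"
  shows "path_in (image \<phi> ` F) n (\<phi> \<circ> f)"
  unfolding path_in_def
proof (intro conjI allI impI)
  show "inj_on (\<phi> \<circ> f) {..<n}"
    using assms unfolding path_in_def by (meson comp_inj_on inj_on_subset subset_UNIV)
  fix i assume "Suc i < n"
  then have "\<phi> ` {f i, f (Suc i)} \<in> image \<phi> ` F"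
    using assms(2) unfolding path_in_def by blast
  then show "{(\<phi> \<circ> f) i, (\<phi> \<circ> f) (Suc i)} \<in> image \<phi> ` F" by simp
qed

lemma path_in_segment:
  assumes "path_in F n f" "j + m \<le> n"
  shows "path_in F m (\<lambda>i. f (j + i))"
proof -
  have "x = y" if "f (j + x) = f (j + y)" "x < m" "y < m" for x y
    using inj_onD[of f "{..<n}" "j + x" "j + y"] assms that by (simp add: path_in_def)
  then show ?thesis
    using assms unfolding path_in_def inj_on_def by auto
qed

lemma path_in_join:
  assumes f: "path_in F (Suc n) f" and g: "path_in F m g"
    and disj: "f ` {..n} \<inter> g ` {..<m} = {}" and edge: "{f n, g 0} \<in> F"
  shows "path_in F (Suc n + m) (\<lambda>i. if i \<le> n then f i else g (i - Suc n))"
    (is "path_in F _ ?h")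
  unfolding path_in_def
proof (intro conjI allI impI)
  have "f i \<noteq> g (j - Suc n)" if "i \<le> n" "n < j" "j < Suc n + m" for i j
  proof -
    have "j - Suc n < m" using that by linarith
    then show ?thesis using disj that(1) by (auto simp: disjoint_iff)
  qed
  moreover have "i = j" if "g (i - Suc n) = g (j - Suc n)" "n < i" "n < j" "i < Suc n + m" "j < Suc n + m" for i j
  proof -
    have "i - Suc n < m" "j - Suc n < m" using that by linarith+
    with that(1) g have "i - Suc n = j - Suc n"
      unfolding path_in_def inj_on_def by blast
    then show ?thesis using that by linarith
  qed
  moreover have "i = j" if "f i = f j" "i \<le> n" "j \<le> n" for i j
    using f that unfolding path_in_def inj_on_def by (meson lessThan_iff less_Suc_eq_le)
  ultimately show "inj_on ?h {..<Suc n + m}"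
    unfolding inj_on_def by (smt (verit) lessThan_iff not_le)
next
  fix i assume i: "Suc i < Suc n + m"
  consider "Suc i \<le> n" | "i = n" | "n < i" by linarith
  then show "{?h i, ?h (Suc i)} \<in> F"
  proof cases
    case 3
    then have "Suc (i - Suc n) < m" "Suc i - Suc n = Suc (i - Suc n)" using i by linarith+
    with 3 g show ?thesis by (simp add: path_in_def)
  qed (use f edge in \<open>auto simp: path_in_def\<close>)
qed

lemma has_copy_star_graph:
  assumes "inj_on w {..<k}" "v \<notin> w ` {..<k}" "\<And>i. i < k \<Longrightarrow> {v, w i} \<in> F"
  shows "has_copy (star_graph k) F"
  unfolding has_copy_def
proof (intro exI conjI ballI)
  let ?f = "\<lambda>i. if i = 0 then v else w (i - 1)"
  show "inj_on ?f (fst (star_graph k))"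
    using assms(1,2) unfolding inj_on_def star_graph_def
    by (auto simp: image_iff) (metis Suc_le_eq Suc_pred lessThan_iff neq0_conv)+
  show "?f ` e \<in> F" if e: "e \<in> snd (star_graph k)" for e
  proof -
    obtain i where "e = {0, i}" "1 \<le> i" "i \<le> k"
      using e unfolding star_graph_def by auto
    then have "{v, w (i - 1)} \<in> F" "?f ` e = {v, w (i - 1)}"
      by (auto intro!: assms(3))
    then show ?thesis by simp
  qed
qed

lemma has_copy_relabel:
  assumes "inj \<phi>" "has_copy G F"
  shows "has_copy G (image \<phi> ` F)"
proof -
  obtain f where "inj_on f (fst G)" "\<forall>e\<in>snd G. f ` e \<in> F"
    using assms(2) unfolding has_copy_def by blast
  then have "inj_on (\<phi> \<circ> f) (fst G)" "\<forall>e\<in>snd G. (\<phi> \<circ> f) ` e \<in> image \<phi> ` F"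
    using assms(1) by (auto simp: image_comp[symmetric] intro: comp_inj_on inj_on_subset)
  then show ?thesis
    unfolding has_copy_def by blast
qed

definition target :: "nat \<Rightarrow> nat \<Rightarrow> nat set set \<Rightarrow> nat set set \<Rightarrow> bool" where
  "target k n R B \<longleftrightarrow> has_copy (star_graph k) R \<or> (\<exists>f. path_in B n f)"

lemma builder_wins_within_iff_target:
  "builder_wins_within (star_graph k) (path_graph n) t \<longleftrightarrow> forces (target k n) t {} {}"
  unfolding builder_wins_within_iff_forces has_copy_path_graph_iff target_def[abs_def] by (rule refl)

lemma target_mono: "target k n R B \<Longrightarrow> R \<subseteq> R' \<Longrightarrow> B \<subseteq> B' \<Longrightarrow> target k n R' B'"
  unfolding target_def by (meson has_copy_mono path_in_mono)

text \<open>Once the red star is there, the remaining rounds of a plan do no harm. This settles the case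
  in which Painter concedes early.\<close>

lemma target_if_star:
  assumes "has_copy (star_graph k) R"
  shows "forces (target k n) t R B"
proof (rule forces_stable)
  show "target k n (insert e R) B" "target k n R (insert e B)" if "target k n R B" for e R B
    by (rule target_mono[OF that]; blast)+
  show "target k n R B" using assms by (simp add: target_def)
qed

text \<open>Builder plays the \<open>k\<close> edges from \<open>v\<close> to the vertices \<open>w i\<close>: if Painter colours
  all of them red, they are the star. Old blue edges are retained, so a blue edge found here can be
  joined to a blue path that exists already.\<close>

lemma forces_probe:
  assumes w: "inj_on w {..<k}" "v \<notin> w ` {..<k}"
  shows "forces (\<lambda>R' B'. has_copy (star_graph k) R' \<or> (B \<subseteq> B' \<and> (\<exists>i<k. {v, w i} \<in> B'))) k R B"
proof -
  let ?Q = "\<lambda>j R' B'. B \<subseteq> B' \<and> ((\<forall>i<j. {v, w i} \<in> R') \<or> (\<exists>i<j. {v, w i} \<in> B'))"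
  have "forces (?Q j) j R B" if "j \<le> k" for j
    using that
  proof (induction j)
    case (Suc j)
    have "v \<noteq> w j" using w(2) Suc.prems by auto
    then have e: "{v, w j} \<in> nsets UNIV 2" by (simp add: nsets_def)
    have "forces (?Q (Suc j)) 1 R' B'" if "?Q j R' B'" for R' B'
      unfolding One_nat_def forces.simps
      by (intro bexI[OF _ e]) (use that in \<open>auto simp: less_Suc_eq\<close>)
    with Suc have "forces (?Q (Suc j)) (j + 1) R B"
      by (intro forces_trans[where P = "?Q j"]) auto
    then show ?case by simp
  qed simp
  then have "forces (?Q k) k R B" by simp
  then show ?thesis
    by (rule forces_weaken) (use has_copy_star_graph[OF w] in blast)
qed

section \<open>The recursive inequalities\<close>

text \<open>One more vertex costs at most \<open>k\<close> rounds: probe \<open>k\<close> vertices off the path from its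
  last vertex.\<close>

lemma forces_extend:
  assumes "forces (target k (Suc n)) s R B"
  shows "forces (target k (Suc (Suc n))) (s + k) R B"
  using assms
proof (rule forces_trans)
  fix R B assume "target k (Suc n) R B"
  then consider "has_copy (star_graph k) R" | f where "path_in B (Suc n) f"
    unfolding target_def by blast
  then show "forces (target k (Suc (Suc n))) k R B"
  proof cases
    case 2
    obtain N where N: "\<And>i. i \<le> n \<Longrightarrow> f i < N"
      using finite_nat_set_iff_bounded[of "f ` {..n}"] by auto
    let ?w = "\<lambda>i. N + i"
    have "f n < N" using N by simp
    then have w: "inj_on ?w {..<k}" "f n \<notin> ?w ` {..<k}" by auto
    from forces_probe[OF w] show ?thesis
    proof (rule forces_weaken)
      fix R' B' assume "has_copy (star_graph k) R' \<or> (B \<subseteq> B' \<and> (\<exists>i<k. {f n, N + i} \<in> B'))"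
      then show "target k (Suc (Suc n)) R' B'"
      proof
        assume "B \<subseteq> B' \<and> (\<exists>i<k. {f n, N + i} \<in> B')"
        then obtain i where i: "B \<subseteq> B'" "{f n, N + i} \<in> B'" by blast
        have "path_in B' (Suc n) f" using 2 i path_in_mono by blast
        moreover have "path_in B' 1 (\<lambda>_. N + i)" by (simp add: path_in_def inj_on_def)
        moreover have "f ` {..n} \<inter> (\<lambda>_. N + i) ` {..<1} = {}"
        proof -
          have "f j \<noteq> N + i" if "j \<le> n" for j using N[OF that] by simp
          then show ?thesis by blast
        qed
        ultimately have "path_in B' (Suc n + 1) (\<lambda>j. if j \<le> n then f j else N + i)"
          using i(2) by (rule path_in_join)
        then show ?thesis unfolding target_def Suc_eq_plus1 by blast
      qed (simp add: target_def)
    qed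
  qed (rule target_if_star)
qed

lemma forces_extend_many:
  assumes "forces (target k (Suc n)) s R B"
  shows "forces (target k (Suc (n + j))) (s + j * k) R B"
proof (induction j)
  case (Suc j)
  have "s + Suc j * k = s + j * k + k" by simp
  with forces_extend[OF Suc] show ?case by (simp only: add_Suc_right)
qed (use assms in simp)

text \<open>The second path is built on the vertices above those of the first, and \<open>k\<close> further
  rounds join the two. The first \<open>i < k\<close> vertices of the second path are lost, where \<open>i\<close>
  is the position of the blue edge; therefore it is built with \<open>k - 1\<close> vertices to spare.\<close>

lemma forces_concat:
  assumes n: "forces (target k (Suc n)) s {} {}" and m: "forces (target k (m + k)) t {} {}"
  shows "forces (target k (Suc n + Suc m)) (s + (t + k)) {} {}"
  using n
proof (rule forces_trans)
  fix R B assume "target k (Suc n) R B"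
  then consider "has_copy (star_graph k) R" | f where "path_in B (Suc n) f"
    unfolding target_def by blast
  then show "forces (target k (Suc n + Suc m)) (t + k) R B"
  proof cases
    case 2
    obtain N where N: "\<And>i. i \<le> n \<Longrightarrow> f i < N"
      using finite_nat_set_iff_bounded[of "f ` {..n}"] by auto
    have inj: "inj ((+) N)" by simp
    have "forces (\<lambda>R' B'. \<exists>R'' B''. target k (m + k) R'' B'' \<and>
        R' = R \<union> image ((+) N) ` R'' \<and> B' = B \<union> image ((+) N) ` B'') t R B"
      using forces_relabel[OF inj m, where R\<^sub>0 = R and B\<^sub>0 = B]
      by (simp only: image_empty Un_empty_right)
    then show ?thesis
    proof (rule forces_trans)
      fix R\<^sub>1 B\<^sub>1
      assume "\<exists>R'' B''. target k (m + k) R'' B'' \<and>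
        R\<^sub>1 = R \<union> image ((+) N) ` R'' \<and> B\<^sub>1 = B \<union> image ((+) N) ` B''"
      then obtain R'' B'' where t: "target k (m + k) R'' B''"
        and R1: "R\<^sub>1 = R \<union> image ((+) N) ` R''" and B1: "B\<^sub>1 = B \<union> image ((+) N) ` B''"
        by blast
      from t consider "has_copy (star_graph k) R''" | g where "path_in B'' (m + k) g"
        unfolding target_def by blast
      then show "forces (target k (Suc n + Suc m)) k R\<^sub>1 B\<^sub>1"
      proof cases
        case 1
        have "has_copy (star_graph k) R\<^sub>1"
          unfolding R1 by (rule has_copy_mono[OF has_copy_relabel[OF inj 1]]) simp
        then show ?thesis by (rule target_if_star)
      next
        case g: 2
        define w where "w = (+) N \<circ> g"
        have w: "path_in B\<^sub>1 (m + k) w"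
          unfolding w_def B1 by (rule path_in_mono[OF path_in_relabel[OF inj g]]) simp
        have f: "path_in B\<^sub>1 (Suc n) f"
          unfolding B1 by (rule path_in_mono[OF 2]) simp
        have fw: "f i \<noteq> w j" if "i \<le> n" for i j
          using N[OF that] by (simp add: w_def)
        have "inj_on w {..<k}"
          using w inj_on_subset[of w "{..<m + k}" "{..<k}"] by (simp add: path_in_def)
        moreover have "f n \<notin> w ` {..<k}" using fw by blast
        ultimately show ?thesis
        proof (rule forces_weaken[OF forces_probe])
          fix R' B' assume "has_copy (star_graph k) R' \<or> (B\<^sub>1 \<subseteq> B' \<and> (\<exists>i<k. {f n, w i} \<in> B'))"
          then show "target k (Suc n + Suc m) R' B'"
          proof
            assume "B\<^sub>1 \<subseteq> B' \<and> (\<exists>i<k. {f n, w i} \<in> B')"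
            then obtain i where i: "B\<^sub>1 \<subseteq> B'" "i < k" "{f n, w i} \<in> B'" by blast
            have "path_in B' (Suc n) f" using f i path_in_mono by blast
            moreover have "path_in B' (Suc m) (\<lambda>j. w (i + j))"
              by (rule path_in_segment[OF path_in_mono[OF w i(1)]]) (use i(2) in simp)
            moreover have "f ` {..n} \<inter> (\<lambda>j. w (i + j)) ` {..<Suc m} = {}" using fw by auto
            moreover have "{f n, w (i + 0)} \<in> B'" using i(3) by simp
            ultimately have "path_in B' (Suc n + Suc m) (\<lambda>j. if j \<le> n then f j else w (i + (j - Suc n)))"
              by (rule path_in_join)
            then show ?thesis unfolding target_def by blast
          qed (simp add: target_def)
        qed
      qed
    qed
  qed (rule target_if_star)
qed

lemma forces_target_0: "forces (target k 0) 0 {} {}" and forces_target_1: "forces (target k 1) 0 {} {}"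
  by (auto simp: target_def path_in_def)

abbreviation star_path_number :: "nat \<Rightarrow> nat \<Rightarrow> nat" where
  "star_path_number k n \<equiv> online_ramsey (star_graph k) (path_graph n)"

text \<open>Extending a single vertex repeatedly shows that some number of rounds suffices, so the least
  such number has the property that defines it.\<close>

lemma forces_star_path_number: "forces (target k n) (star_path_number k n) {} {}"
proof -
  have "\<exists>t. forces (target k n) t {} {}"
    using forces_target_0 forces_extend_many[OF forces_target_1[unfolded One_nat_def], of k]
    by (cases n) fastforce+
  then show ?thesis
    unfolding online_ramsey_def builder_wins_within_iff_target by (rule LeastI_ex)
qed

lemma star_path_number_le: "forces (target k n) t {} {} \<Longrightarrow> star_path_number k n \<le> t"
  unfolding online_ramsey_def builder_wins_within_iff_target by (rule Least_le)

lemma star_path_number_add: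
  assumes "k \<ge> 1"
  shows "star_path_number k (n + m) \<le> star_path_number k n + star_path_number k m + k\<^sup>2"
proof (cases "n = 0 \<or> m = 0")
  case False
  then obtain n' m' where nm: "n = Suc n'" "m = Suc m'" by (metis not0_implies_Suc)
  have "forces (target k (m' + k)) (star_path_number k m + (k - 1) * k) {} {}"
    using forces_extend_many[OF forces_star_path_number[of k m, unfolded nm], of "k - 1"] assms
    by (simp add: nm)
  from forces_concat[OF _ this, of n'] forces_star_path_number[of k n]
  have "star_path_number k (n + m)
      \<le> star_path_number k n + (star_path_number k m + (k - 1) * k + k)"
    unfolding nm by (blast intro: star_path_number_le)
  moreover have "(k - 1) * k + k = k\<^sup>2"
    using assms by (cases k) (simp_all add: power2_eq_square)
  ultimately show ?thesis by linarith
qed auto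

section \<open>Subadditive sequences\<close>

text \<open>Fekete's lemma: if \<open>u m / m\<close> is close to the infimum, then division with remainder,
  \<open>n = q * m + r\<close>, gives \<open>u n \<le> q * u m + u r\<close>, in which \<open>u r\<close> is bounded because
  \<open>r < m\<close>.\<close>

lemma subadditive_div_tendsto_INF:
  fixes u :: "nat \<Rightarrow> real"
  assumes sub: "\<And>m n. u (m + n) \<le> u m + u n" and nonneg: "\<And>n. 0 \<le> u n"
  shows "(\<lambda>n. u n / n) \<longlonglongrightarrow> (INF n\<in>{1..}. u n / n)" (is "_ \<longlonglongrightarrow> ?L")
proof (rule LIMSEQ_I)
  fix e :: real assume "0 < e"
  have bdd: "bdd_below ((\<lambda>n. u n / n) ` {1..})"
    by (rule bdd_belowI2[of _ 0]) (simp add: nonneg)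
  have "?L < ?L + e / 2" using \<open>0 < e\<close> by simp
  then obtain m where m: "m \<ge> 1" "u m / m < ?L + e / 2"
    by (subst (asm) cINF_less_iff[OF _ bdd]) auto
  have mult: "u (q * m + r) \<le> q * u m + u r" for q r
  proof (induction q)
    case (Suc q)
    then show ?case using sub[of m "q * m + r"] by (simp add: algebra_simps)
  qed simp
  define M where "M = (\<Sum>r<m. u r)"
  have M: "u r \<le> M" if "r < m" for r
    unfolding M_def using that by (intro member_le_sum) (auto simp: nonneg)
  obtain N where N: "2 * M / e < real N" using reals_Archimedean2 by blast
  have "norm (u n / n - ?L) < e" if n: "n \<ge> max 1 N" for n
  proof -
    have n0: "n \<ge> 1" "N \<le> n" using n by auto
    have "real (n div m) * real m \<le> real n"
      unfolding of_nat_mult[symmetric] of_nat_le_iff by simp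
    then have "real (n div m) * u m \<le> n * (u m / m)"
      using mult_right_mono[of "real (n div m) * m" n "u m / m"] m(1) nonneg[of m] by simp
    moreover have "u n \<le> (n div m) * u m + u (n mod m)"
      using mult[of "n div m" "n mod m"] by simp
    ultimately have "u n \<le> n * (u m / m) + M"
      using M[of "n mod m"] m(1) by simp
    then have "u n / n \<le> u m / m + M / n"
      using n0 by (simp add: field_simps)
    moreover have "M / n < e / 2"
    proof -
      have "2 * M / e < real n" using N n0 by linarith
      then show ?thesis using \<open>0 < e\<close> n0 by (simp add: field_simps)
    qed
    moreover have "?L \<le> u n / n"
      by (rule cINF_lower[OF bdd]) (use n0 in simp)
    ultimately show ?thesis using m(2) unfolding real_norm_def by linarith
  qed
  then show "\<exists>no. \<forall>n\<ge>no. norm (u n / n - ?L) < e" by blast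
qed

theorem theorem1p4:
  fixes k :: nat
  assumes "k \<ge> 1"
  shows "\<exists>L::real. (\<lambda>n. real (online_ramsey (star_graph k) (path_graph n)) / real n) \<longlonglongrightarrow> L"
proof -
  define u where "u n = real (star_path_number k n + k\<^sup>2)" for n
  have "u (m + n) \<le> u m + u n" for m n
    using star_path_number_add[OF assms, of m n] unfolding u_def of_nat_add[symmetric] of_nat_le_iff
    by linarith
  then have "(\<lambda>n. u n / n) \<longlonglongrightarrow> (INF n\<in>{1..}. u n / n)"
    by (rule subadditive_div_tendsto_INF) (simp add: u_def)
  from tendsto_diff[OF this lim_const_over_n[of "real (k\<^sup>2)"]]
  show ?thesis
    unfolding u_def by (auto simp: diff_divide_distrib[symmetric])
qed

end
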